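(* Let $G$ be an abelian group and $\mathcal A=(A_1,\dots,A_q)$ a tuple of subsets of $G$ such that for each $i$, $A_i$ is a union of $k_i$ unbounded linear sets ($k_i\in\mathbb N$). Then for every $r\in\mathbb N$, $\mathcal A$ is a chromatic asymptotic $(r,\ell)$-approximate group with \[ \ell=\prod_{i=1}^q\binom{(r+1)(k_i-1)}{k_i-1}. \]
   Context: $\mathbb N=\{1,2,\dots\}$, $\mathbb N_0=\{0,1,2,\dots\}$. An unbounded linear set in $G$ is a set of the form $P(a;b_1,\dots,b_d)=\{a+n_1b_1+\cdots+n_db_d:n_1,\dots,n_d\in\mathbb N_0\}$ with $a,b_1,\dots,b_d\in G$. For subsets $X,Y$, $X+Y=\{x+y:x\in X,y\in Y\}$; for $h\in\mathbb N$, $hA$ is the $h$-fold sumset $A+\cdots+A$ and $0A=\{0\}$. For $\mathbf h=(h_1,\dots,h_q)\in\mathbb N_0^q$, $\mathbf h\cdot\mathcal A=h_1A_1+\cdots+h_qA_q$, $r\mathbf h=(rh_1,\dots,rh_q)$, and $\mathbf h\preceq\mathbf h'$ means $h_i\le h_i'$ for all $i$. $\mathcal A$ is a chromatic asymptotic $(r,\ell)$-approximate group if there is $\mathbf h_0\in\mathbb N_0^q$ such that for every $\mathbf h\succeq\mathbf h_0$ there is $X_{\mathbf h}\subseteq G$ with $|X_{\mathbf h}|\le\ell$ and $(r\mathbf h)\cdot\mathcal A\subseteq X_{\mathbf h}+\mathbf h\cdot\mathcal A$. *)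

theory Defs
  imports Main "HOL-Library.Set_Algebras"
begin

text \<open>
  Sums of sets are those of \<^theory>\<open>HOL-Library.Set_Algebras\<close>: \<open>X + Y\<close> is the Minkowski sum and
  \<open>0\<close> is the singleton of the neutral element, so \<open>\<Sum>\<close> over sets is the iterated sumset.
\<close>

definition nat_mult :: "nat \<Rightarrow> 'a::comm_monoid_add \<Rightarrow> 'a" where
  "nat_mult n x = (\<Sum>j = 1..n. x)"

text \<open>
  \<open>P(a; b\<^sub>1, \<dots>, b\<^sub>d)\<close>.  The generators may vanish, so allowing \<open>d = 0\<close> adds no new sets:
  \<open>P(a; ) = P(a; 0)\<close>.
\<close>

definition linear_set :: "'a::ab_group_add \<Rightarrow> nat \<Rightarrow> (nat \<Rightarrow> 'a) \<Rightarrow> 'a set" where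
  "linear_set a d b = {a + (\<Sum>j = 1..d. nat_mult (n j) (b j)) | n :: nat \<Rightarrow> nat. True}"

definition unbounded_linear :: "'a::ab_group_add set \<Rightarrow> bool" where
  "unbounded_linear S \<longleftrightarrow> (\<exists>a d b. S = linear_set a d b)"

definition union_of_unbounded_linear :: "nat \<Rightarrow> 'a::ab_group_add set \<Rightarrow> bool" where
  "union_of_unbounded_linear k S \<longleftrightarrow>
     (\<exists>L :: nat \<Rightarrow> 'a set. (\<forall>j\<in>{1..k}. unbounded_linear (L j)) \<and> S = (\<Union>j\<in>{1..k}. L j))"

text \<open>The \<open>h\<close>-fold sumset; it is \<^emph>\<open>not\<close> the dilate \<open>{h a | a \<in> A}\<close>.\<close>

definition sumset :: "nat \<Rightarrow> 'a::ab_group_add set \<Rightarrow> 'a set" where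
  "sumset h A = (\<Sum>j = 1..h. A)"

lemma sumset_0: "sumset 0 A = {0}"
  by (simp add: sumset_def set_zero)

lemma sumset_Suc: "sumset (Suc h) A = {x + y | x y. x \<in> sumset h A \<and> y \<in> A}"
  by (auto simp: sumset_def set_plus_def add.commute)

text \<open>
  A \<open>q\<close>-tuple is a function on \<open>nat\<close> of which only the values at \<open>1, \<dots>, q\<close> are used.
\<close>

definition chromatic_sumset :: "nat \<Rightarrow> (nat \<Rightarrow> nat) \<Rightarrow> (nat \<Rightarrow> 'a::ab_group_add set) \<Rightarrow> 'a set" where
  "chromatic_sumset q h A = (\<Sum>i = 1..q. sumset (h i) (A i))"

definition chromatic_asymptotic_approximate_group ::
    "nat \<Rightarrow> nat \<Rightarrow> nat \<Rightarrow> (nat \<Rightarrow> 'a::ab_group_add set) \<Rightarrow> bool" where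
  "chromatic_asymptotic_approximate_group r l q A \<longleftrightarrow>
     (\<exists>h0 :: nat \<Rightarrow> nat. \<forall>h :: nat \<Rightarrow> nat. (\<forall>i\<in>{1..q}. h0 i \<le> h i) \<longrightarrow>
        (\<exists>X. finite X \<and> card X \<le> l \<and>
             chromatic_sumset q (\<lambda>i. r * h i) A \<subseteq> X + chromatic_sumset q h A))"

end

theory Submission
  imports Defs
begin

text \<open>
  Let \<open>A = (a\<^sub>0 + M\<^sub>0) \<union> \<dots> \<union> (a\<^sub>d + M\<^sub>d)\<close> with \<open>d = k - 1\<close> and monoids \<open>M\<^sub>j\<close>.  An element of \<open>(rh)A\<close>
  is \<open>\<Sum>\<^sub>j (m\<^sub>j a\<^sub>j + z\<^sub>j)\<close> with \<open>\<Sum>\<^sub>j m\<^sub>j = rh\<close>, \<open>z\<^sub>j \<in> M\<^sub>j\<close>, and \<open>z\<^sub>j = 0\<close> whenever \<open>m\<^sub>j = 0\<close>.  Put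
  \<open>s = \<lfloor>(h - 1)/d\<rfloor>\<close> and, for \<open>j < d\<close> with \<open>m\<^sub>j > 0\<close>, write \<open>m\<^sub>j = s t\<^sub>j + u\<^sub>j\<close> with \<open>1 \<le> u\<^sub>j \<le> s\<close>.
  The \<open>u\<^sub>j\<close> have the same support as the \<open>m\<^sub>j\<close> and add up to less than \<open>h\<close>, so giving \<open>a\<^sub>d\<close> the
  remaining positive multiplicity \<open>h - \<Sum>\<^sub>j u\<^sub>j\<close> leaves an element of \<open>hA\<close>; what was split off depends
  only on \<open>t\<close>.  For large \<open>h\<close> one has \<open>\<Sum>\<^sub>j t\<^sub>j \<le> rd\<close>, which leaves \<open>(rd + d) choose d\<close> vectors \<open>t\<close>.
  For several sets the translation sets are added up.
\<close>

section \<open>Multiples and the monoids \<open>P(0; b)\<close>\<close>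

lemma nat_mult_0 [simp]: "nat_mult 0 x = 0"
  by (simp add: nat_mult_def)

lemma nat_mult_Suc [simp]: "nat_mult (Suc n) x = x + nat_mult n x"
  by (simp add: nat_mult_def add.commute)

lemma nat_mult_add: "nat_mult (m + n) x = nat_mult m x + nat_mult n x"
  by (induction m) (simp_all add: add.assoc)

lemma nat_mult_sum: "nat_mult (\<Sum>j\<in>J. f j) x = (\<Sum>j\<in>J. nat_mult (f j) x)"
  by (induction J rule: infinite_finite_induct) (simp_all add: nat_mult_add)

lemma linear_set_translate: "linear_set a d b = (+) a ` linear_set 0 d b"
  by (force simp: linear_set_def)

lemma zero_in_linear_set: "0 \<in> linear_set 0 d b"
proof -
  have "0 + (\<Sum>j = 1..d. nat_mult 0 (b j)) \<in> linear_set 0 d b"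
    unfolding linear_set_def by (rule CollectI, rule exI[of _ "\<lambda>_. 0"]) simp
  then show ?thesis by simp
qed

lemma add_in_linear_set:
  assumes "x \<in> linear_set 0 d b" "y \<in> linear_set 0 d b"
  shows "x + y \<in> linear_set 0 d b"
proof -
  obtain m n where "x = (\<Sum>j = 1..d. nat_mult (m j) (b j))" "y = (\<Sum>j = 1..d. nat_mult (n j) (b j))"
    using assms by (auto simp: linear_set_def)
  then have "x + y = 0 + (\<Sum>j = 1..d. nat_mult (m j + n j) (b j))"
    by (simp add: nat_mult_add sum.distrib)
  then show ?thesis
    unfolding linear_set_def by (intro CollectI exI[of _ "\<lambda>j. m j + n j"]) simp
qed

section \<open>Sumsets of unions of translated monoids\<close>

lemma sumset_Suc_plus: "sumset (Suc h) A = A + sumset h A"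
  by (simp add: sumset_def add.commute)

lemma sumset_add: "sumset (m + n) A = sumset m A + sumset n A"
  by (induction m) (simp_all add: sumset_Suc_plus sumset_0 add.assoc flip: set_zero)

lemma sumset_mono: "A \<subseteq> B \<Longrightarrow> sumset h A \<subseteq> sumset h B"
  by (induction h) (simp_all add: sumset_0 sumset_Suc_plus set_plus_mono2)

lemma sum_in_sumset:
  assumes "\<And>j. j \<in> J \<Longrightarrow> y j \<in> sumset (m j) A" "finite J"
  shows "(\<Sum>j\<in>J. y j) \<in> sumset (\<Sum>j\<in>J. m j) A"
  using assms(2,1)
  by (induction J rule: finite_induct) (simp_all add: sumset_0 sumset_add set_plus_intro)

text \<open>One summand \<open>a + z\<close> carries all of \<open>z\<close>, and the other
  \<open>n - 1\<close> summands are \<open>a + 0\<close>. For \<open>n = 0\<close> no summand can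
  carry \<open>z\<close>, which must then vanish.\<close>

lemma in_sumset_translate:
  assumes "0 \<in> M" "z \<in> M" "n = 0 \<Longrightarrow> z = 0"
  shows "nat_mult n a + z \<in> sumset n ((+) a ` M)"
proof (cases n)
  case 0
  then show ?thesis using assms by (simp add: sumset_0)
next
  case (Suc p)
  have "a \<in> (+) a ` M" using assms(1) by force
  then have "nat_mult p a \<in> sumset p ((+) a ` M)" for p
    by (induction p) (simp_all add: sumset_0 sumset_Suc_plus set_plus_intro)
  moreover have "a + z \<in> (+) a ` M" using assms(2) by blast
  ultimately have "(a + z) + nat_mult p a \<in> sumset (Suc p) ((+) a ` M)"
    unfolding sumset_Suc_plus by (rule set_plus_intro[rotated])
  then show ?thesis by (simp add: Suc algebra_simps)
qed

lemma sumset_UN_translates_I: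
  assumes "finite J" "\<And>j. j \<in> J \<Longrightarrow> 0 \<in> M j" "\<And>j. j \<in> J \<Longrightarrow> z j \<in> M j"
    "\<And>j. j \<in> J \<Longrightarrow> n j = 0 \<Longrightarrow> z j = 0"
  shows "(\<Sum>j\<in>J. nat_mult (n j) (a j) + z j) \<in> sumset (\<Sum>j\<in>J. n j) (\<Union>j\<in>J. (+) (a j) ` M j)"
proof (rule sum_in_sumset)
  fix j assume "j \<in> J"
  then have "sumset (n j) ((+) (a j) ` M j) \<subseteq> sumset (n j) (\<Union>j\<in>J. (+) (a j) ` M j)"
    by (intro sumset_mono) blast
  then show "nat_mult (n j) (a j) + z j \<in> sumset (n j) (\<Union>j\<in>J. (+) (a j) ` M j)"
    using in_sumset_translate[of "M j" "z j" "n j" "a j"] assms \<open>j \<in> J\<close> by blast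
qed (fact assms(1))

text \<open>Summands are grouped by the translate they come from; closure under addition merges the
  monoid parts of each group into a single \<open>z j\<close>. An empty group contributes
  \<open>0\<close>.\<close>

lemma sumset_UN_translates_E:
  assumes "finite J" "\<And>j. j \<in> J \<Longrightarrow> 0 \<in> M j"
    and "\<And>j x y. j \<in> J \<Longrightarrow> x \<in> M j \<Longrightarrow> y \<in> M j \<Longrightarrow> x + y \<in> M j"
    and "y \<in> sumset h (\<Union>j\<in>J. (+) (a j) ` M j)"
  obtains m z where "(\<Sum>j\<in>J. m j) = h" "\<And>j. j \<in> J \<Longrightarrow> z j \<in> M j"
    "\<And>j. j \<in> J \<Longrightarrow> m j = 0 \<Longrightarrow> z j = 0" "y = (\<Sum>j\<in>J. nat_mult (m j) (a j) + z j)"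
proof -
  have "\<exists>m z. (\<Sum>j\<in>J. m j) = h \<and> (\<forall>j\<in>J. z j \<in> M j) \<and> (\<forall>j\<in>J. m j = 0 \<longrightarrow> z j = 0) \<and>
      y = (\<Sum>j\<in>J. nat_mult (m j) (a j) + z j)"
    using assms(4)
  proof (induction h arbitrary: y)
    case 0
    then show ?case
      using assms(2) by (intro exI[of _ "\<lambda>_. 0"]) (simp add: sumset_0)
  next
    case (Suc h)
    then obtain i w y' where i: "i \<in> J" "w \<in> M i" "y = (a i + w) + y'"
      and y': "y' \<in> sumset h (\<Union>j\<in>J. (+) (a j) ` M j)"
      unfolding sumset_Suc_plus by (auto elim!: set_plus_elim)
    obtain m z where mz: "(\<Sum>j\<in>J. m j) = h" "\<forall>j\<in>J. z j \<in> M j" "\<forall>j\<in>J. m j = 0 \<longrightarrow> z j = 0"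
      "y' = (\<Sum>j\<in>J. nat_mult (m j) (a j) + z j)"
      using Suc.IH[OF y'] by blast
    let ?m = "m(i := Suc (m i))" and ?z = "z(i := w + z i)"
    have "(\<Sum>j\<in>J. ?m j) = Suc h"
      using mz(1) assms(1) i(1) by (simp add: sum.remove[OF assms(1) i(1)])
    moreover have "y = (\<Sum>j\<in>J. nat_mult (?m j) (a j) + ?z j)"
      using mz(4) i assms(1) by (simp add: sum.remove[OF assms(1) i(1)] algebra_simps)
    moreover have "\<forall>j\<in>J. ?z j \<in> M j" "\<forall>j\<in>J. ?m j = 0 \<longrightarrow> ?z j = 0"
      using mz(2,3) i assms(3) by auto
    ultimately show ?case by blast
  qed
  then show ?thesis using that by blast
qed

section \<open>Splitting the multiplicities\<close>

text \<open>Division with remainder in \<open>{1..s}\<close> instead of \<open>{0..<s}\<close>, so that the support is preserved.\<close>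

lemma div_with_positive_remainder:
  fixes m s :: nat
  assumes "0 < s"
  obtains t u where "m = s * t + u" "u \<le> s" "u = 0 \<longleftrightarrow> m = 0"
proof (cases m)
  case 0
  then show ?thesis using that[of 0 0] by simp
next
  case (Suc p)
  have "p = s * (p div s) + p mod s" by simp
  then have "m = s * (p div s) + Suc (p mod s)" using Suc by linarith
  then show ?thesis
    using that[of "p div s" "Suc (p mod s)"] Suc assms by (simp add: Suc_leI)
qed

text \<open>Each remainder is at most the quotient \<open>s\<close> of \<open>h - 1\<close> by
  \<open>d\<close>, so together they stay below \<open>h\<close>. The lower bound on
  \<open>h\<close> forces \<open>r * d < s\<close>, which makes the rounding error in
  \<open>h \<le> d * s + d\<close> too small to let the \<open>t j\<close> add up to more than
  \<open>r * d\<close>.\<close>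

lemma multiplicity_split:
  fixes m :: "nat \<Rightarrow> nat"
  assumes "0 < h" "d * (r * d + 1) < h" "(\<Sum>j<Suc d. m j) = r * h"
  obtains t u where "\<And>j. j < d \<Longrightarrow> m j = (h - 1) div d * t j + u j"
    "\<And>j. j < d \<Longrightarrow> u j = 0 \<Longrightarrow> m j = 0" "(\<Sum>j<d. t j) \<le> r * d" "(\<Sum>j<d. u j) < h"
proof (cases "d = 0")
  case True
  \<comment> \<open>Here the divisor \<open>(h - 1) div d\<close> is \<open>0\<close>, but all sums
    are empty and no index is constrained.\<close>
  with that[of "\<lambda>_. 0" "\<lambda>_. 0"] assms(1) show ?thesis by simp
next
  case False
  define s where "s = (h - 1) div d"
  have s: "r * d < s"
  proof -
    have "(r * d + 1) * d div d \<le> s"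
      unfolding s_def using assms(2) by (intro div_le_mono) (simp add: mult.commute)
    then show ?thesis using False by simp
  qed
  have ds: "d * s \<le> h - 1" "h - 1 < d * s + d"
    using False mult_div_mod_eq[of d "h - 1"] mod_less_divisor[of d "h - 1"] unfolding s_def by linarith+
  have "\<forall>j. \<exists>t u. m j = s * t + u \<and> u \<le> s \<and> (u = 0 \<longleftrightarrow> m j = 0)"
    using div_with_positive_remainder[of s] s by (metis gr_zeroI not_less_zero)
  then obtain t u where tu: "\<And>j. m j = s * t j + u j" "\<And>j. u j \<le> s" "\<And>j. u j = 0 \<longleftrightarrow> m j = 0"
    by metis
  have "(\<Sum>j<d. u j) \<le> d * s"
    using sum_mono[of "{..<d}" u "\<lambda>_. s"] tu(2) by simp
  then have u: "(\<Sum>j<d. u j) < h" using ds assms(1) by linarith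
  have "s * (\<Sum>j<d. t j) \<le> (\<Sum>j<d. m j)"
    unfolding sum_distrib_left by (intro sum_mono) (simp add: tu(1))
  also have "\<dots> \<le> r * h" using assms(3) by simp
  also have "\<dots> \<le> r * (d * s + d)" using ds by (intro mult_left_mono) auto
  \<comment> \<open>After cancelling \<open>r * d * s\<close> this is exactly
    \<open>r * d < s\<close>.\<close>
  also have "\<dots> < s * (r * d + 1)" using s by (simp add: algebra_simps)
  finally have "(\<Sum>j<d. t j) < r * d + 1" by (rule mult_left_less_imp_less) simp
  then have "(\<Sum>j<d. t j) \<le> r * d" by simp
  then show ?thesis using that[of t u] tu(1,3) u unfolding s_def by blast
qed

section \<open>Covering for one set\<close>

lemma sumset_cover:
  fixes a :: "nat \<Rightarrow> 'a::ab_group_add"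
  assumes M0: "\<And>j. j \<le> d \<Longrightarrow> 0 \<in> M j"
    and Madd: "\<And>j x y. j \<le> d \<Longrightarrow> x \<in> M j \<Longrightarrow> y \<in> M j \<Longrightarrow> x + y \<in> M j"
    and "1 \<le> r" "0 < h" "d * (r * d + 1) < h"
  defines "A \<equiv> \<Union>j<Suc d. (+) (a j) ` M j"
  shows "\<exists>X. finite X \<and> card X \<le> ((r + 1) * d) choose d \<and> sumset (r * h) A \<subseteq> X + sumset h A"
proof -
  define s where "s = (h - 1) div d"
  \<comment> \<open>The last entry is a slack: it turns the condition that the \<open>t j\<close>
    add up to at most \<open>r * d\<close> into an equation, so that the vectors can be counted as
    lists with prescribed sum.\<close>
  define T where "T = {l :: nat list. length l = Suc d \<and> sum_list l = r * d}"
  \<comment> \<open>Each block of \<open>s\<close> copies of \<open>a j\<close> that is split off is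
    paid for by \<open>s\<close> copies of \<open>a d\<close>, so the total multiplicity of the
    translate is always \<open>(r - 1) * h\<close>.\<close>
  define f where "f l = (\<Sum>j<d. nat_mult (s * l ! j) (a j) - nat_mult (s * l ! j) (a d))
      + nat_mult ((r - 1) * h) (a d)" for l
  have "card T = (r * d + d) choose (r * d)"
    unfolding T_def by (simp add: card_length_sum_list)
  also have "\<dots> = ((r + 1) * d) choose d"
    using binomial_symmetric[of d "r * d + d"] by (simp add: algebra_simps)
  finally have card: "card T = ((r + 1) * d) choose d" .
  then have "0 < card T" by simp
  then have fin: "finite T" by (rule card_ge_0_finite)
  have "sumset (r * h) A \<subseteq> f ` T + sumset h A"
  proof
    fix y assume y_in: "y \<in> sumset (r * h) A"
    obtain m z where m: "(\<Sum>j<Suc d. m j) = r * h" and z: "\<And>j. j \<in> {..<Suc d} \<Longrightarrow> z j \<in> M j"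
      "\<And>j. j \<in> {..<Suc d} \<Longrightarrow> m j = 0 \<Longrightarrow> z j = 0"
      and y: "y = (\<Sum>j<Suc d. nat_mult (m j) (a j) + z j)"
    proof (rule sumset_UN_translates_E)
      show "y \<in> sumset (r * h) (\<Union>j<Suc d. (+) (a j) ` M j)"
        using y_in by (simp only: A_def)
    qed (use M0 Madd in auto)
    obtain t u where tu: "\<And>j. j < d \<Longrightarrow> m j = s * t j + u j"
      "\<And>j. j < d \<Longrightarrow> u j = 0 \<Longrightarrow> m j = 0" "(\<Sum>j<d. t j) \<le> r * d" "(\<Sum>j<d. u j) < h"
      using multiplicity_split[OF assms(4,5) m] unfolding s_def by blast
    \<comment> \<open>The last multiplicity is positive because the \<open>u j\<close> add up to
      less than \<open>h\<close>; hence \<open>z d\<close> needs no condition, even if it is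
      nonzero, and every \<open>z j\<close> can be kept unchanged.\<close>
    define n where "n j = (if j < d then u j else h - (\<Sum>j<d. u j))" for j
    define l where "l = map t [0..<d] @ [r * d - (\<Sum>j<d. t j)]"
    have lT: "l \<in> T"
      using tu(3) by (simp add: l_def T_def interv_sum_list_conv_sum_set_nat atLeast0LessThan)
    have l_nth: "l ! j = t j" if "j < d" for j
      using that by (simp add: l_def nth_append)
    have "(\<Sum>j<Suc d. n j) = h"
      using tu(4) by (simp add: n_def)
    moreover have "(\<Sum>j<Suc d. nat_mult (n j) (a j) + z j) \<in> sumset (\<Sum>j<Suc d. n j) A"
      unfolding A_def
    proof (rule sumset_UN_translates_I)
      fix j assume j: "j \<in> {..<Suc d}" "n j = 0"
      then show "z j = 0"
        using tu(2,4) z(2)[of j] by (auto simp: n_def split: if_splits)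
    qed (use M0 z in auto)
    ultimately have nA: "(\<Sum>j<Suc d. nat_mult (n j) (a j) + z j) \<in> sumset h A"
      by simp
    have "(\<Sum>j<d. m j) = (\<Sum>j<d. s * t j) + (\<Sum>j<d. u j)"
      by (simp add: tu(1) sum.distrib)
    moreover have "r * h = (r - 1) * h + h"
      using assms(3) by (cases r) auto
    \<comment> \<open>The totals \<open>r * h\<close> of \<open>m\<close> and \<open>h\<close> of
      \<open>n\<close> are compared. The equation is kept free of differences, since subtraction on
      \<open>nat\<close> truncates; terms are moved across only in the group.\<close>
    ultimately have "m d + (\<Sum>j<d. s * t j) = (r - 1) * h + n d"
      using m tu(4) by (simp add: n_def)
    then have "nat_mult (m d + (\<Sum>j<d. s * t j)) (a d) = nat_mult ((r - 1) * h + n d) (a d)"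
      by simp
    then have last: "nat_mult (m d) (a d)
        = nat_mult ((r - 1) * h) (a d) + nat_mult (n d) (a d) - (\<Sum>j<d. nat_mult (s * t j) (a d))"
      by (simp add: nat_mult_add nat_mult_sum algebra_simps)
    have "(\<Sum>j<d. nat_mult (m j) (a j))
        = (\<Sum>j<d. nat_mult (s * t j) (a j)) + (\<Sum>j<d. nat_mult (n j) (a j))"
      by (simp add: tu(1) n_def nat_mult_add sum.distrib)
    with last have "y = f l + (\<Sum>j<Suc d. nat_mult (n j) (a j) + z j)"
      by (simp add: y f_def l_nth sum.distrib sum_subtractf algebra_simps)
    then show "y \<in> f ` T + sumset h A"
      using lT nA by (simp add: set_plus_intro)
  qed
  moreover have "card (f ` T) \<le> ((r + 1) * d) choose d"
    using card_image_le[OF fin, of f] card by simp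
  ultimately show ?thesis using fin by blast
qed

text \<open>\<open>P(a; b)\<close> is the translate by \<open>a\<close> of \<open>P(0; b)\<close>,
  which contains \<open>0\<close> and is closed under addition. The indices are shifted to start at
  \<open>0\<close>.\<close>

lemma union_of_unbounded_linear_translates:
  assumes "union_of_unbounded_linear (Suc d) A"
  obtains a M where "A = (\<Union>j<Suc d. (+) (a j) ` M j)" "\<And>j. j \<le> d \<Longrightarrow> 0 \<in> M j"
    "\<And>j x y. j \<le> d \<Longrightarrow> x \<in> M j \<Longrightarrow> y \<in> M j \<Longrightarrow> x + y \<in> M j"
proof -
  obtain L where L: "\<forall>j\<in>{1..Suc d}. unbounded_linear (L j)" "A = (\<Union>j\<in>{1..Suc d}. L j)"
    using assms unfolding union_of_unbounded_linear_def by blast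
  have "\<forall>j\<in>{..<Suc d}. \<exists>a e b. L (Suc j) = linear_set a e b"
    using L(1) unfolding unbounded_linear_def by simp
  then obtain a e b where ab: "\<forall>j\<in>{..<Suc d}. L (Suc j) = linear_set (a j) (e j) (b j)"
    by metis
  have "A = (\<Union>j<Suc d. L (Suc j))"
    unfolding L(2) image_Suc_lessThan[symmetric] by (simp only: image_image)
  also have "\<dots> = (\<Union>j<Suc d. (+) (a j) ` linear_set 0 (e j) (b j))"
    using ab by (intro SUP_cong) (simp_all flip: linear_set_translate)
  finally show ?thesis
    using that[of a "\<lambda>j. linear_set 0 (e j) (b j)"] zero_in_linear_set add_in_linear_set by blast
qed

section \<open>Combining several sets\<close>

lemma card_set_plus_le:
  fixes X Y :: "'a::plus set"
  assumes "finite X" "finite Y"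
  shows "card (X + Y) \<le> card X * card Y"
  using card_image_le[of "X \<times> Y" "\<lambda>(x, y). x + y"] assms
  by (simp add: set_plus_image card_cartesian_product)

lemma card_set_sum_le:
  fixes X :: "'i \<Rightarrow> 'a::comm_monoid_add set"
  assumes "finite I" "\<And>i. i \<in> I \<Longrightarrow> finite (X i)"
  shows "finite (\<Sum>i\<in>I. X i) \<and> card (\<Sum>i\<in>I. X i) \<le> (\<Prod>i\<in>I. card (X i))"
  using assms
proof (induction I rule: finite_induct)
  case empty
  then show ?case by (simp add: set_zero)
next
  case (insert i I)
  have "card (X i + (\<Sum>i\<in>I. X i)) \<le> card (X i) * card (\<Sum>i\<in>I. X i)"
    using insert by (intro card_set_plus_le) auto
  also have "\<dots> \<le> card (X i) * (\<Prod>i\<in>I. card (X i))"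
    using insert by (intro mult_left_mono) auto
  finally show ?case using insert by (simp add: finite_set_plus)
qed

lemma set_sum_mono:
  fixes B C :: "'i \<Rightarrow> 'a::comm_monoid_add set"
  assumes "\<And>i. i \<in> I \<Longrightarrow> B i \<subseteq> C i"
  shows "(\<Sum>i\<in>I. B i) \<subseteq> (\<Sum>i\<in>I. C i)"
  using assms by (induction I rule: infinite_finite_induct) (simp_all add: set_plus_mono2)

theorem theorem1p15:
  fixes A :: "nat \<Rightarrow> 'a::ab_group_add set"
    and k :: "nat \<Rightarrow> nat"
    and q r :: nat
  assumes "\<And>i. i \<in> {1..q} \<Longrightarrow> 1 \<le> k i"
    and "\<And>i. i \<in> {1..q} \<Longrightarrow> union_of_unbounded_linear (k i) (A i)"
    and "1 \<le> r"
  shows "chromatic_asymptotic_approximate_group r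
           (\<Prod>i = 1..q. ((r + 1) * (k i - 1)) choose (k i - 1)) q A"
  unfolding chromatic_asymptotic_approximate_group_def
\<comment> \<open>Each set gets its own threshold from \<open>sumset_cover\<close>. The
  \<open>Suc\<close> makes the bound strict and also ensures \<open>0 < h i\<close> when
  \<open>k i = 1\<close>.\<close>
proof (rule exI[of _ "\<lambda>i. Suc ((k i - 1) * (r * (k i - 1) + 1))"], intro allI impI)
  fix h :: "nat \<Rightarrow> nat"
  assume h: "\<forall>i\<in>{1..q}. Suc ((k i - 1) * (r * (k i - 1) + 1)) \<le> h i"
  have "\<exists>X. finite X \<and> card X \<le> ((r + 1) * (k i - 1)) choose (k i - 1)
      \<and> sumset (r * h i) (A i) \<subseteq> X + sumset (h i) (A i)" if i: "i \<in> {1..q}" for i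
  proof -
    have "union_of_unbounded_linear (Suc (k i - 1)) (A i)"
      using assms(1,2)[OF i] by simp
    then obtain a M where "A i = (\<Union>j<Suc (k i - 1). (+) (a j) ` M j)"
      "\<And>j. j \<le> k i - 1 \<Longrightarrow> 0 \<in> M j"
      "\<And>j x y. j \<le> k i - 1 \<Longrightarrow> x \<in> M j \<Longrightarrow> y \<in> M j \<Longrightarrow> x + y \<in> M j"
      by (rule union_of_unbounded_linear_translates) (rule that)
    moreover have "0 < h i" "(k i - 1) * (r * (k i - 1) + 1) < h i"
      using h i by fastforce+
    ultimately show ?thesis
      using sumset_cover[of "k i - 1" M r "h i" a] assms(3) by simp
  qed
  then obtain X where X: "\<And>i. i \<in> {1..q} \<Longrightarrow> finite (X i)"
    "\<And>i. i \<in> {1..q} \<Longrightarrow> card (X i) \<le> ((r + 1) * (k i - 1)) choose (k i - 1)"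
    "\<And>i. i \<in> {1..q} \<Longrightarrow> sumset (r * h i) (A i) \<subseteq> X i + sumset (h i) (A i)"
    by metis
  have "card (\<Sum>i = 1..q. X i) \<le> (\<Prod>i = 1..q. card (X i))"
    using card_set_sum_le[of "{1..q}" X] X(1) by simp
  also have "\<dots> \<le> (\<Prod>i = 1..q. ((r + 1) * (k i - 1)) choose (k i - 1))"
    using X(2) by (intro prod_mono) auto
  finally have "card (\<Sum>i = 1..q. X i) \<le> (\<Prod>i = 1..q. ((r + 1) * (k i - 1)) choose (k i - 1))" .
  moreover have "finite (\<Sum>i = 1..q. X i)"
    using card_set_sum_le[of "{1..q}" X] X(1) by simp
  moreover have "chromatic_sumset q (\<lambda>i. r * h i) A \<subseteq> (\<Sum>i = 1..q. X i) + chromatic_sumset q h A"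
    \<comment> \<open>Minkowski addition is commutative and associative, so the translation sets can
      be regrouped with their sumsets and the inclusions added index by index.\<close>
    unfolding chromatic_sumset_def sum.distrib[symmetric] by (rule set_sum_mono) (rule X(3))
  ultimately show "\<exists>X. finite X \<and> card X \<le> (\<Prod>i = 1..q. ((r + 1) * (k i - 1)) choose (k i - 1)) \<and>
      chromatic_sumset q (\<lambda>i. r * h i) A \<subseteq> X + chromatic_sumset q h A"
    by (intro exI conjI)
qed

end
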